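(* Let $G$ be a finite group and $H\le G$ a subgroup. For the family $\{\rho_g\}_{g\in G}$ of density matrices on $\mathbb{C}[G]$ corresponding to random left cosets of the conjugate subgroups $H^g$, $$\rho_g=\frac{1}{|G|}\sum_{c\in G}|cH^g\rangle\langle cH^g|,$$ with the uniform distribution $p_g=1/|G|$ on $g\in G$, the pretty good measurement $\{E_g\}_{g\in G}$ maximizes the probability of correctly measuring $g$. That is, for every measurement $\{F_g\}_{g\in G}$ on $\mathbb{C}[G]$, $$\frac{1}{|G|}\sum_{g\in G}\operatorname{tr}(F_g\rho_g)\;\le\;\frac{1}{|G|}\sum_{g\in G}\operatorname{tr}(E_g\rho_g).$$
   Context: $\mathbb{C}[G]$ is the Hilbert space with orthonormal basis $\{|x\rangle : x\in G\}$. For $g\in G$, $H^g=g^{-1}Hg$, and for $c\in G$, $|cH^g\rangle=\frac{1}{\sqrt{|H|}}\sum_{h\in H^g}|ch\rangle$. A measurement (POVM) with outcomes in a finite set $I$ is a family of positive semidefinite operators $\{F_i\}_{i\in I}$ satisfying the completeness condition $\sum_i F_i=\mathbb{1}$, where the family is allowed to be completed by one additional positive semidefinite operator corresponding to an extra outcome that never counts as a correct answer (so equivalently $\sum_{i\in I}F_i\le \mathbb{1}$). If state $\rho_i$ occurs with probability $p_i$, the success probability is $\sum_i p_i\operatorname{tr}(F_i\rho_i)$. The pretty good measurement (PGM) of a family of density matrices $\rho_i$ with probabilities $p_i$ is $\{E_i\}$, where $E_i=p_iM^{-1/2}\rho_iM^{-1/2}$, $M=\sum_i p_i\rho_i$,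 and $M^{-1/2}$ is the inverse square root of $M$ on the image of $M$ (extended by zero on the orthogonal complement), so that $(M^{-1/2})^2M$ is the orthogonal projection onto the image of $M$. If $M$ is not of full rank, the PGM is completed by the additional operator projecting onto the orthogonal complement of the image of $M$. *)

theory Defs
  imports "HOL-Analysis.Analysis" "HOL-Algebra.Coset"
begin

text \<open>
  For a finite type \<open>'a\<close>, the space \<open>complex ^ 'a\<close> has the orthonormal basis \<open>axis x 1\<close> indexed by
  the elements \<open>x\<close> of the type. It serves as \<open>\<complex>[G]\<close> for a group \<open>G\<close> whose carrier is the whole
  type; operators on it are matrices \<open>complex ^ 'a ^ 'a\<close>.
\<close>

definition cinner :: "complex ^ 'n \<Rightarrow> complex ^ 'n \<Rightarrow> complex"
  where "cinner v w = (\<Sum>i\<in>UNIV. cnj (v $ i) * w $ i)"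

definition hermitian :: "complex ^ 'n ^ 'n \<Rightarrow> bool"
  where "hermitian A \<longleftrightarrow> (\<forall>i j. A $ i $ j = cnj (A $ j $ i))"

text \<open>For a Hermitian matrix the form below is real, so taking the real part loses nothing.\<close>

definition pos_semidef :: "complex ^ 'n ^ 'n \<Rightarrow> bool"
  where "pos_semidef A \<longleftrightarrow> hermitian A \<and> (\<forall>v. 0 \<le> Re (cinner v (A *v v)))"

definition ket_bra :: "complex ^ 'n \<Rightarrow> complex ^ 'n \<Rightarrow> complex ^ 'n ^ 'n"
  where "ket_bra v w = (\<chi> i j. v $ i * cnj (w $ j))"

definition orth_projection_onto :: "complex ^ 'n ^ 'n \<Rightarrow> (complex ^ 'n) set \<Rightarrow> bool"
  where "orth_projection_onto P S \<longleftrightarrow>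
    hermitian P \<and> P ** P = P \<and> range ((*v) P) = S"

text \<open>
  An outcome outside \<open>I\<close>, with operator \<open>F\<^sub>0\<close>, is always allowed; it may be zero, and it never counts
  as a correct answer.
\<close>

definition measurement_on :: "'i set \<Rightarrow> ('i \<Rightarrow> complex ^ 'n ^ 'n) \<Rightarrow> bool"
  where "measurement_on I F \<longleftrightarrow>
    (\<forall>i\<in>I. pos_semidef (F i)) \<and>
    (\<exists>F\<^sub>0. pos_semidef F\<^sub>0 \<and> (\<Sum>i\<in>I. F i) + F\<^sub>0 = mat 1)"

text \<open>
  The trace of a product of two positive semidefinite matrices is real; \<open>Re\<close> only changes the type.
\<close>

definition success_probability ::
    "'i set \<Rightarrow> ('i \<Rightarrow> real) \<Rightarrow> ('i \<Rightarrow> complex ^ 'n ^ 'n) \<Rightarrow> ('i \<Rightarrow> complex ^ 'n ^ 'n) \<Rightarrow> real"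
  where "success_probability I p \<rho> F = (\<Sum>i\<in>I. p i * Re (trace (F i ** \<rho> i)))"

text \<open>
  \<open>M\<^bsup>-1/2\<^esup>\<close> for a positive semidefinite \<open>M\<close>: the positive semidefinite matrix vanishing on the
  orthogonal complement of the image of \<open>M\<close> and such that \<open>(M\<^bsup>-1/2\<^esup>)\<^sup>2 M\<close> is the orthogonal
  projection onto that image. These properties determine it, by uniqueness of positive semidefinite
  square roots.
\<close>

definition inverse_sqrt :: "complex ^ 'n ^ 'n \<Rightarrow> complex ^ 'n ^ 'n"
  where "inverse_sqrt M = (THE R. pos_semidef R \<and>
    (\<forall>v. (\<forall>u\<in>range ((*v) M). cinner u v = 0) \<longrightarrow> R *v v = 0) \<and>
    orth_projection_onto (R ** R ** M) (range ((*v) M)))"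

definition average_state ::
    "'i set \<Rightarrow> ('i \<Rightarrow> real) \<Rightarrow> ('i \<Rightarrow> complex ^ 'n ^ 'n) \<Rightarrow> complex ^ 'n ^ 'n"
  where "average_state I p \<rho> = (\<Sum>i\<in>I. p i *\<^sub>R \<rho> i)"

text \<open>
  The operator of the extra outcome, the projection onto the orthogonal complement of the image of
  \<open>average_state I p \<rho>\<close>, is not part of the family: it is the \<open>F\<^sub>0\<close> of \<open>measurement_on\<close>, which is
  determined by completeness.
\<close>

definition pretty_good_measurement ::
    "'i set \<Rightarrow> ('i \<Rightarrow> real) \<Rightarrow> ('i \<Rightarrow> complex ^ 'n ^ 'n) \<Rightarrow> 'i \<Rightarrow> complex ^ 'n ^ 'n"
  where "pretty_good_measurement I p \<rho> i =
    p i *\<^sub>R (inverse_sqrt (average_state I p \<rho>) ** \<rho> i ** inverse_sqrt (average_state I p \<rho>))"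

definition conj_subgroup :: "('a, 'b) monoid_scheme \<Rightarrow> 'a set \<Rightarrow> 'a \<Rightarrow> 'a set"
  where "conj_subgroup G H g = (\<lambda>h. inv\<^bsub>G\<^esub> g \<otimes>\<^bsub>G\<^esub> h \<otimes>\<^bsub>G\<^esub> g) ` H"

text \<open>The state \<open>|cH\<^sup>g\<rangle>\<close>.\<close>

definition coset_state ::
    "('a::finite, 'b) monoid_scheme \<Rightarrow> 'a set \<Rightarrow> 'a \<Rightarrow> 'a \<Rightarrow> complex ^ 'a"
  where "coset_state G H g c =
    (1 / sqrt (real (card H))) *\<^sub>R (\<Sum>h\<in>conj_subgroup G H g. axis (c \<otimes>\<^bsub>G\<^esub> h) 1)"

definition coset_density ::
    "('a::finite, 'b) monoid_scheme \<Rightarrow> 'a set \<Rightarrow> 'a \<Rightarrow> complex ^ 'a ^ 'a"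
  where "coset_density G H g =
    (1 / real (card (carrier G))) *\<^sub>R
      (\<Sum>c\<in>carrier G. ket_bra (coset_state G H g c) (coset_state G H g c))"

end

theory Submission
  imports Defs
begin

text \<open>
  The matrix entry of \<open>\<rho> g\<close> at \<open>(x, y)\<close> depends only on \<open>x\<^sup>-\<^sup>1 y\<close>: it is \<open>1 / |G|\<close> times the indicator of
  \<open>H\<^sup>g\<close>. Hence \<open>\<rho> g\<close> is \<open>a = |H| / |G|\<close> times a projection, and the average state \<open>M\<close>, being given by a
  class function, commutes with every \<open>\<rho> g\<close>. Each of these projections lies below the projection \<open>Q\<close>
  onto the image of \<open>M\<close>, so \<open>tr (F g \<rho> g) \<le> a tr (F g Q)\<close> and every measurement succeeds with
  probability at most \<open>a tr Q / |G|\<close>. Since \<open>M\<^bsup>-1/2\<^esup>\<close> commutes with whatever commutes with \<open>M\<close>, the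
  pretty good measurement attains this bound.
\<close>

subsection \<open>Real spectral theorem\<close>

text \<open>Near \<open>t = 0\<close> the linear term dominates, so a nonzero \<open>b\<close> would
  make the polynomial negative on one side of 0.\<close>

lemma quadratic_nonneg_imp_linear_zero:
  fixes a b :: real
  assumes "\<And>t. 0 \<le> a * t\<^sup>2 + b * t"
  shows "b = 0"
proof -
  \<comment> \<open>Any positive \<open>s\<close> above \<open>a\<close> makes the value at
    \<open>- b / s\<close> negative unless \<open>b = 0\<close>.\<close>
  define s where "s = \<bar>a\<bar> + 1"
  have s: "s > 0" "a < s" by (auto simp: s_def)
  have "a * (- b / s)\<^sup>2 + b * (- b / s) = b\<^sup>2 * (a - s) / s\<^sup>2"
    using s by (simp add: field_simps power2_eq_square)
  then have "0 \<le> b\<^sup>2 * (a - s) / s\<^sup>2"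
    using assms[of "- b / s"] by simp
  then have "0 \<le> b\<^sup>2 * (a - s)"
    using s by (simp add: zero_le_divide_iff)
  then show ?thesis
    using s by (simp add: zero_le_mult_iff)
qed

text \<open>The form attains its minimum 0 on \<open>S\<close> at \<open>v\<close>, so its
  derivative \<open>2 * (w \<bullet> g v)\<close> in each direction \<open>w\<close> of
  \<open>S\<close> vanishes. This serves both the eigenvector argument and kernels of positive
  semidefinite matrices.\<close>

lemma nonneg_form_zero:
  fixes g :: "'a::real_inner \<Rightarrow> 'a"
  assumes "linear g" "subspace S"
    and sym: "\<And>x y. g x \<bullet> y = x \<bullet> g y"
    and pos: "\<And>x. x \<in> S \<Longrightarrow> 0 \<le> x \<bullet> g x"
    and v: "v \<in> S" "v \<bullet> g v = 0" and w: "w \<in> S"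
  shows "w \<bullet> g v = 0"
proof -
  interpret linear g by fact
  have "0 \<le> (w \<bullet> g w) * t\<^sup>2 + (2 * (w \<bullet> g v)) * t" for t
  proof -
    have "v + t *\<^sub>R w \<in> S"
      using v w \<open>subspace S\<close> by (simp add: subspace_add subspace_scale)
    from pos[OF this] show ?thesis
      using v(2) sym[of v w]
      by (simp add: add scale inner_add_left inner_add_right power2_eq_square inner_commute
          algebra_simps)
  qed
  then show ?thesis
    using quadratic_nonneg_imp_linear_zero by fastforce
qed

text \<open>Maximise the Rayleigh quotient on \<open>S\<close>. If \<open>\<mu>\<close> is the
  maximum, reached at \<open>v\<close>, then \<open>\<mu> - f\<close> has a nonnegative form on
  \<open>S\<close> that vanishes at \<open>v\<close>, so it sends \<open>v\<close> to a vector of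
  \<open>S\<close> orthogonal to \<open>S\<close>.\<close>

lemma self_adjoint_eigenvector:
  fixes f :: "'a::euclidean_space \<Rightarrow> 'a"
  assumes lin: "linear f" and sym: "\<And>x y. f x \<bullet> y = x \<bullet> f y"
    and S: "subspace S" "S \<noteq> {0}" and inv: "\<And>x. x \<in> S \<Longrightarrow> f x \<in> S"
  obtains v \<mu> where "v \<in> S" "norm v = 1" "f v = \<mu> *\<^sub>R v"
proof -
  interpret linear f by fact
  let ?K = "S \<inter> sphere 0 1"
  obtain x where x: "x \<in> S" "x \<noteq> 0" using S subspace_0 by blast
  have "compact ?K"
    using closed_subspace[OF S(1)] by (simp add: closed_Int_compact)
  moreover have "x /\<^sub>R norm x \<in> ?K"
    using x S by (simp add: subspace_scale)
  moreover have "continuous_on ?K (\<lambda>x. x \<bullet> f x)"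
    using lin by (intro continuous_intros linear_continuous_on linear_conv_bounded_linear[THEN iffD1])
  ultimately obtain v where v: "v \<in> ?K" and max: "\<And>y. y \<in> ?K \<Longrightarrow> y \<bullet> f y \<le> v \<bullet> f v"
    using continuous_attains_sup[of ?K "\<lambda>x. x \<bullet> f x"] by (metis empty_iff)
  define \<mu> where "\<mu> = v \<bullet> f v"
  define g where "g = (\<lambda>x. \<mu> *\<^sub>R x - f x)"
  have vv: "v \<bullet> v = 1"
    using v by (simp add: dot_square_norm)
  have pos: "0 \<le> y \<bullet> g y" if "y \<in> S" for y
  proof (cases "y = 0")
    case False
    have "y /\<^sub>R norm y \<in> ?K" using that False S by (simp add: subspace_scale)
    from max[OF this] have "(y \<bullet> f y) / (norm y)\<^sup>2 \<le> \<mu>"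
      by (simp add: scale \<mu>_def power2_eq_square divide_inverse mult_ac)
    then have "y \<bullet> f y \<le> \<mu> * (norm y)\<^sup>2"
      using False by (simp add: field_simps)
    then show ?thesis by (simp add: g_def inner_diff_right power2_norm_eq_inner)
  qed simp
  have "linear g"
    unfolding g_def using lin by (intro linear_compose_sub linear_compose_scale_right linear_ident)
  moreover have "g x \<bullet> y = x \<bullet> g y" for x y
    by (simp add: g_def inner_diff_left inner_diff_right sym)
  moreover have "v \<bullet> g v = 0"
    by (simp add: g_def inner_diff_right vv flip: \<mu>_def)
  moreover have "g v \<in> S"
    using v S inv by (simp add: g_def subspace_diff subspace_scale)
  \<comment> \<open>The direction \<open>w\<close> is taken to be \<open>g v\<close> itself.\<close>
  ultimately have "g v \<bullet> g v = 0"
    using nonneg_form_zero[of g S v "g v"] S pos v by blast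
  then have "f v = \<mu> *\<^sub>R v" by (simp add: g_def)
  then show ?thesis using that[of v \<mu>] v by simp
qed

text \<open>Eigenvectors are split off one at a time, by induction on the dimension. Allowing any
  invariant \<open>S\<close> lets the induction pass to the orthogonal complement of an
  eigenvector.\<close>

lemma self_adjoint_eigenbasis:
  fixes f :: "'a::euclidean_space \<Rightarrow> 'a"
  assumes lin: "linear f" and sym: "\<And>x y. f x \<bullet> y = x \<bullet> f y"
    and "subspace S" and "\<And>x. x \<in> S \<Longrightarrow> f x \<in> S"
  shows "\<exists>B\<subseteq>S. finite B \<and> pairwise orthogonal B \<and>
    (\<forall>b\<in>B. norm b = 1 \<and> (\<exists>\<mu>. f b = \<mu> *\<^sub>R b)) \<and> S \<subseteq> span B"
  using assms(3,4)
proof (induction "dim S" arbitrary: S rule: less_induct)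
  case less
  show ?case
  proof (cases "S = {0}")
    case True
    then show ?thesis by (intro exI[of _ "{}"]) auto
  next
    case False
    obtain v \<mu> where v: "v \<in> S" "norm v = 1" "f v = \<mu> *\<^sub>R v"
      using self_adjoint_eigenvector[OF lin sym less.prems(1) False less.prems(2)] by blast
    define T where "T = S \<inter> {x. orthogonal v x}"
    have T: "subspace T"
      unfolding T_def using less.prems(1) subspace_orthogonal_to_vector subspace_inter by blast
    have vv: "v \<bullet> v = 1" using v by (simp add: dot_square_norm)
    then have "v \<notin> T" by (simp add: T_def orthogonal_def)
    then have "span T \<subset> span S"
      using v less.prems(1) T by (metis T_def Int_lower1 psubsetI span_eq_iff)
    then have "dim T < dim S" by (rule dim_psubset)
    \<comment> \<open>Symmetry turns \<open>v \<bullet> f x\<close> into a multiple of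
      \<open>v \<bullet> x\<close>, so the complement is invariant.\<close>
    moreover have "f x \<in> T" if "x \<in> T" for x
      using that less.prems(2) v sym[of v x] by (simp add: T_def orthogonal_def)
    ultimately obtain B where B: "B \<subseteq> T" "finite B" "pairwise orthogonal B" "T \<subseteq> span B"
      "\<forall>b\<in>B. norm b = 1 \<and> (\<exists>\<mu>. f b = \<mu> *\<^sub>R b)"
      using less.hyps[OF _ T] by blast
    have "S \<subseteq> span (insert v B)"
    proof
      fix x assume "x \<in> S"
      then have "x - (v \<bullet> x) *\<^sub>R v \<in> T"
        using v vv less.prems(1)
        by (simp add: T_def orthogonal_def inner_diff_right subspace_diff subspace_scale)
      then show "x \<in> span (insert v B)"
        using B(4) span_breakdown_eq by blast
    qed
    moreover have "pairwise orthogonal (insert v B)"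
      using B(1,3) by (intro pairwise_orthogonal_insert) (auto simp: T_def)
    ultimately show ?thesis
      using B v less.prems(1) by (intro exI[of _ "insert v B"]) (auto simp: T_def)
  qed
qed

subsection \<open>Hermitian and positive semidefinite matrices\<close>

text \<open>The bridge from the complex form to the real inner product of the spectral theorem
  above.\<close>

lemma inner_eq_Re_cinner: "v \<bullet> w = Re (cinner v w)"
  by (simp add: inner_vec_def cinner_def inner_complex_def)

lemma cinner_add_right: "cinner w (u + v) = cinner w u + cinner w v"
  and cinner_scale_right: "cinner v (c *s w) = c * cinner v w"
  and cinner_scaleR_left: "cinner (r *\<^sub>R v) w = r * cinner v w"
  and cinner_scaleR_right: "cinner v (r *\<^sub>R w) = r * cinner v w"
  by (simp_all add: cinner_def algebra_simps sum.distrib sum_distrib_left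
      scaleR_conv_of_real[where 'a = complex] vector_scaleR_component)

lemma cinner_sum_right: "cinner v (\<Sum>i\<in>A. f i) = (\<Sum>i\<in>A. cinner v (f i))"
  by (induction A rule: infinite_finite_induct) (simp_all add: cinner_add_right, simp_all add: cinner_def)

lemma cnj_cinner: "cnj (cinner v w) = cinner w v"
  by (simp add: cinner_def mult.commute)

lemma cinner_axis: "cinner (axis i 1) v = v $ i"
  by (simp add: cinner_def axis_def if_distrib[of cnj] if_distrib[of "\<lambda>x. x * _"] cong: if_cong)

lemma cinner_self_eq_0: "Re (cinner v v) = 0 \<longleftrightarrow> v = 0"
  by (simp flip: inner_eq_Re_cinner)

lemma matrix_vector_mult_axis_nth: "(A *v axis j 1) $ i = (A::complex ^ 'n ^ 'm) $ i $ j"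
  by (simp add: matrix_vector_mult_def axis_def if_distrib[of "\<lambda>x. _ * x"] cong: if_cong)

section \<open>Hermitian matrices\<close>

lemma hermitianI: "(\<And>i j. A $ i $ j = cnj (A $ j $ i)) \<Longrightarrow> hermitian A"
  unfolding hermitian_def by blast

lemma hermitian_cnj_nth: "hermitian A \<Longrightarrow> cnj (A $ j $ i) = A $ i $ j"
  by (metis hermitian_def)

lemma hermitian_iff_cinner: "hermitian A \<longleftrightarrow> (\<forall>v w. cinner (A *v v) w = cinner v (A *v w))"
proof
  assume A: "hermitian A"
  have "cinner (A *v v) w = cinner v (A *v w)" for v w
  proof -
    have "cinner (A *v v) w = (\<Sum>j\<in>UNIV. \<Sum>i\<in>UNIV. cnj (v $ i) * (A $ i $ j * w $ j))"
      by (simp add: cinner_def matrix_vector_mult_def sum_distrib_left hermitian_cnj_nth[OF A] mult_ac)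
    also have "\<dots> = (\<Sum>i\<in>UNIV. \<Sum>j\<in>UNIV. cnj (v $ i) * (A $ i $ j * w $ j))"
      by (rule sum.swap)
    also have "\<dots> = cinner v (A *v w)"
      by (simp add: cinner_def matrix_vector_mult_def sum_distrib_left)
    finally show ?thesis .
  qed
  then show "\<forall>v w. cinner (A *v v) w = cinner v (A *v w)" by blast
next
  assume *: "\<forall>v w. cinner (A *v v) w = cinner v (A *v w)"
  have "A $ i $ j = cnj (A $ j $ i)" for i j
    using *[rule_format, of "axis i 1" "axis j 1"] cnj_cinner[of "axis j 1" "A *v axis i 1"]
    by (simp add: cinner_axis matrix_vector_mult_axis_nth)
  then show "hermitian A" by (rule hermitianI)
qed

lemma hermitian_cinner: "hermitian A \<Longrightarrow> cinner (A *v v) w = cinner v (A *v w)"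
  by (simp add: hermitian_iff_cinner)

lemma hermitian_sum: "(\<And>i. i \<in> I \<Longrightarrow> hermitian (A i)) \<Longrightarrow> hermitian (\<Sum>i\<in>I. A i)"
  by (rule hermitianI) (simp add: hermitian_cnj_nth)

lemma hermitian_scaleR: "hermitian A \<Longrightarrow> hermitian (r *\<^sub>R A)"
  by (rule hermitianI) (simp add: hermitian_cnj_nth)

lemma hermitian_diff: "hermitian A \<Longrightarrow> hermitian B \<Longrightarrow> hermitian (A - B)"
  by (rule hermitianI) (simp add: hermitian_cnj_nth)

lemma hermitian_mat_1: "hermitian (mat 1)"
  by (simp add: hermitian_def mat_def)

lemma hermitian_commuting_mult:
  assumes "hermitian A" "hermitian B" "A ** B = B ** A"
  shows "hermitian (A ** B)"
  unfolding hermitian_iff_cinner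
  by (metis assms hermitian_cinner matrix_vector_mul_assoc)

lemma hermitian_sandwich: "hermitian A \<Longrightarrow> hermitian C \<Longrightarrow> hermitian (C ** A ** C)"
  unfolding hermitian_iff_cinner[of "C ** A ** C"]
  by (simp add: hermitian_cinner flip: matrix_vector_mul_assoc)

section \<open>Closure properties and kernels of positive semidefinite matrices\<close>

lemma pos_semidef_hermitian: "pos_semidef A \<Longrightarrow> hermitian A"
  by (simp add: pos_semidef_def)

lemma pos_semidef_cinner: "pos_semidef A \<Longrightarrow> 0 \<le> Re (cinner v (A *v v))"
  by (simp add: pos_semidef_def)

lemma matrix_vector_mult_sum_left: "(\<Sum>i\<in>I. A i) *v v = (\<Sum>i\<in>I. A i *v v)"
  by (induction I rule: infinite_finite_induct) (simp_all add: matrix_vector_mult_add_rdistrib)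

lemma pos_semidef_sum: "(\<And>i. i \<in> I \<Longrightarrow> pos_semidef (A i)) \<Longrightarrow> pos_semidef (\<Sum>i\<in>I. A i)"
  by (auto simp: pos_semidef_def hermitian_sum matrix_vector_mult_sum_left cinner_sum_right intro!: sum_nonneg)

lemma scaleR_matrix_vector_mult:
  "(r *\<^sub>R A) *v v = r *\<^sub>R ((A :: complex ^ 'n ^ 'm) *v v)"
  by (simp add: vec_eq_iff matrix_vector_mult_def scaleR_sum_right)

lemma pos_semidefI:
  "hermitian A \<Longrightarrow> (\<And>v. 0 \<le> Re (cinner v (A *v v))) \<Longrightarrow> pos_semidef A"
  by (simp add: pos_semidef_def)

lemma pos_semidef_scaleR:
  assumes "0 \<le> r" "pos_semidef A"
  shows "pos_semidef (r *\<^sub>R A)"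
proof (rule pos_semidefI)
  show "hermitian (r *\<^sub>R A)"
    by (rule hermitian_scaleR[OF pos_semidef_hermitian[OF assms(2)]])
  show "0 \<le> Re (cinner v (r *\<^sub>R A *v v))" for v
    using assms(1) pos_semidef_cinner[OF assms(2), of v]
    by (simp add: cinner_scaleR_right scaleR_matrix_vector_mult)
qed

lemma pos_semidef_sandwich:
  assumes "pos_semidef A" "hermitian C"
  shows "pos_semidef (C ** A ** C)"
proof (rule pos_semidefI)
  show "hermitian (C ** A ** C)"
    by (rule hermitian_sandwich[OF pos_semidef_hermitian[OF assms(1)] assms(2)])
  show "0 \<le> Re (cinner v (C ** A ** C *v v))" for v
    using pos_semidef_cinner[OF assms(1), of "C *v v"]
    by (simp add: hermitian_cinner[OF assms(2)] flip: matrix_vector_mul_assoc)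
qed

text \<open>\<open>P\<close> is the identity sandwiched between two copies of
  \<open>P\<close>.\<close>

lemma pos_semidef_projection:
  assumes "hermitian P" "P ** P = P"
  shows "pos_semidef P"
proof -
  have "pos_semidef (mat 1 :: complex ^ 'a ^ 'a)"
    by (simp add: pos_semidef_def hermitian_mat_1 inner_eq_Re_cinner[symmetric])
  from pos_semidef_sandwich[OF this assms(1)] show ?thesis by (simp add: assms)
qed

lemma ket_bra_mult: "ket_bra u w *v v = cinner w v *s u"
  by (simp add: vec_eq_iff ket_bra_def matrix_vector_mult_def cinner_def sum_distrib_left mult_ac)

lemma pos_semidef_ket_bra: "pos_semidef (ket_bra v v)"
proof -
  have "cinner w (ket_bra v v *v w) = complex_of_real ((cmod (cinner v w))\<^sup>2)" for w
    unfolding complex_norm_square by (simp add: ket_bra_mult cinner_scale_right cnj_cinner)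
  then show ?thesis
    by (auto simp: pos_semidef_def ket_bra_def intro!: hermitianI)
qed

text \<open>The form is nonnegative and minimal at \<open>v\<close>, so
  \<open>nonneg_form_zero\<close> applies in the direction \<open>A *v v\<close>.\<close>

lemma pos_semidef_cinner_eq_0:
  assumes "pos_semidef A" "Re (cinner v (A *v v)) = 0"
  shows "A *v v = 0"
proof -
  have "linear ((*v) A)" by simp
  moreover have "(A *v x) \<bullet> y = x \<bullet> (A *v y)" for x y
    by (simp add: inner_eq_Re_cinner hermitian_cinner[OF pos_semidef_hermitian[OF assms(1)]])
  moreover have "0 \<le> x \<bullet> (A *v x)" for x
    by (simp add: inner_eq_Re_cinner pos_semidef_cinner[OF assms(1)])
  moreover have "v \<bullet> (A *v v) = 0"
    by (simp add: inner_eq_Re_cinner assms(2))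
  ultimately have "(A *v v) \<bullet> (A *v v) = 0"
    using nonneg_form_zero[of "(*v) A" UNIV v "A *v v"] by simp
  then show ?thesis by simp
qed

lemma matrix_vector_mult_scaleR_right:
  "A *v (r *\<^sub>R v) = r *\<^sub>R ((A :: complex ^ 'n ^ 'm) *v v)"
  by (simp add: vec_eq_iff matrix_vector_mult_def scaleR_sum_right)

lemma matrix_mult_zero_right: "A ** (0 :: complex ^ 'n ^ 'm) = 0"
  by (simp add: matrix_matrix_mult_def vec_eq_iff)

lemma matrix_diff_ldistrib: "A ** (B - C) = A ** B - (A :: complex ^ 'n ^ 'm) ** C"
  and matrix_diff_rdistrib: "(A - D) ** B = A ** B - (D :: complex ^ 'n ^ 'm) ** B"
  by (simp_all add: matrix_eq matrix_vector_mult_diff_distrib matrix_vector_mult_diff_rdistrib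
      flip: matrix_vector_mul_assoc)

text \<open>The adjoint of \<open>A ** C\<close> is \<open>C ** A\<close>.\<close>

lemma hermitian_mult_imp_commute:
  assumes "hermitian A" "hermitian C" "hermitian (A ** C)"
  shows "A ** C = C ** A"
proof -
  have "cinner u ((A ** C) *v v) = cinner u ((C ** A) *v v)" for u v
    using assms
    by (metis hermitian_cinner matrix_vector_mul_assoc)
  then have "(A ** C) *v v = (C ** A) *v v" for v
    unfolding vec_eq_iff by (metis cinner_axis)
  then show ?thesis by (simp add: matrix_eq)
qed

section \<open>Traces and uniqueness of positive semidefinite square roots\<close>

lemma trace_conv_cinner: "trace A = (\<Sum>j\<in>UNIV. cinner (axis j 1) (A *v axis j 1))"
  by (simp add: trace_def cinner_axis matrix_vector_mult_axis_nth)

lemma pos_semidef_trace_nonneg: "pos_semidef A \<Longrightarrow> 0 \<le> Re (trace A)"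
  by (simp add: trace_conv_cinner sum_nonneg pos_semidef_cinner)

text \<open>The diagonal entries are nonnegative with sum 0, so the form vanishes at every basis
  vector, which therefore lies in the kernel.\<close>

lemma pos_semidef_trace_eq_0:
  assumes "pos_semidef A" "Re (trace A) = 0"
  shows "A = 0"
proof -
  have "\<forall>j\<in>UNIV. Re (cinner (axis j 1) (A *v axis j 1)) = 0"
    using assms(2) pos_semidef_cinner[OF assms(1)]
    by (subst sum_nonneg_eq_0_iff[symmetric]) (simp_all add: trace_conv_cinner)
  then have "A *v axis j 1 = 0" for j
    using pos_semidef_cinner_eq_0[OF assms(1)] by blast
  then have "A $ i $ j = 0" for i j
    by (metis matrix_vector_mult_axis_nth zero_index)
  then show ?thesis by (simp add: vec_eq_iff)
qed

text \<open>For \<open>D = R - S\<close>, equality of the squares says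
  \<open>R ** D + D ** S = 0\<close>. Multiplying by \<open>D\<close> and taking traces makes the
  nonnegative traces of \<open>D ** R ** D\<close> and \<open>D ** S ** D\<close> add up to 0. Both
  matrices vanish, hence so does their difference, the cube of \<open>D\<close>; and a nilpotent
  Hermitian matrix is 0.\<close>

lemma pos_semidef_sqrt_unique:
  assumes "pos_semidef R" "pos_semidef S" and eq: "R ** R = S ** S"
  shows "R = S"
proof -
  define D where "D = R - S"
  have herm: "hermitian D"
    unfolding D_def using assms by (intro hermitian_diff pos_semidef_hermitian)
  have "R ** D + D ** S = 0"
    by (simp add: D_def matrix_diff_ldistrib matrix_diff_rdistrib eq)
  then have "D ** (R ** D) + D ** (D ** S) = 0"
    by (simp add: matrix_mult_zero_right flip: matrix_add_ldistrib)
  then have "trace (D ** (R ** D)) + trace (D ** (D ** S)) = 0"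
    by (metis mat_0 trace_0 trace_add)
  moreover have "trace (D ** (D ** S)) = trace (D ** S ** D)"
    by (rule trace_mul_sym)
  ultimately have "Re (trace (D ** R ** D)) + Re (trace (D ** S ** D)) = 0"
    by (metis matrix_mul_assoc plus_complex.sel(1) zero_complex.sel(1))
  moreover have psd: "pos_semidef (D ** R ** D)" "pos_semidef (D ** S ** D)"
    using assms herm by (auto intro: pos_semidef_sandwich)
  ultimately have "D ** R ** D = 0" "D ** S ** D = 0"
    using pos_semidef_trace_nonneg[OF psd(1)] pos_semidef_trace_nonneg[OF psd(2)]
      pos_semidef_trace_eq_0[OF psd(1)] pos_semidef_trace_eq_0[OF psd(2)] by linarith+
  then have D3: "D ** D ** D = 0"
    using matrix_diff_ldistrib[of D R S] matrix_diff_rdistrib[of "D ** R" "D ** S" D]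
    by (simp flip: D_def)
  \<comment> \<open>The squared norm of \<open>D *v v\<close> is the form of \<open>v\<close> with
    \<open>D *v (D *v v)\<close>. Two applications lower the cube of \<open>D\<close> to
    \<open>D\<close>.\<close>
  have sq: "D *v v = 0" if "D *v (D *v v) = 0" for v
  proof -
    have "cinner (D *v v) (D *v v) = 0"
      unfolding hermitian_cinner[OF herm] that by (simp add: cinner_def)
    then show ?thesis using cinner_self_eq_0[of "D *v v"] by simp
  qed
  have "D *v v = 0" for v
    by (rule sq, rule sq) (simp add: matrix_vector_mul_assoc matrix_mul_assoc D3)
  then show ?thesis by (simp add: D_def matrix_eq matrix_vector_mult_diff_rdistrib)
qed

subsection \<open>The inverse square root\<close>

text \<open>
  An orthonormal basis of \<open>complex ^ 'n\<close> as a real inner product space consists of twice as many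
  vectors as a complex one, whence the factor 2 in the resolution of the identity.
\<close>

lemma hermitian_eigenframe:
  assumes "hermitian (A :: complex ^ 'n ^ 'n)"
  obtains B :: "(complex ^ 'n) set" and \<mu> :: "complex ^ 'n \<Rightarrow> real"
  where "finite B" "\<And>b. b \<in> B \<Longrightarrow> norm b = 1" "\<And>b. b \<in> B \<Longrightarrow> A *v b = \<mu> b *\<^sub>R b"
    "\<And>x. (\<Sum>b\<in>B. cinner b x *s b) = 2 *\<^sub>R x"
proof -
  have "\<exists>B\<subseteq>UNIV. finite B \<and> pairwise orthogonal B \<and>
      (\<forall>b\<in>B. norm b = 1 \<and> (\<exists>\<mu>. A *v b = \<mu> *\<^sub>R b)) \<and> UNIV \<subseteq> span B"
    by (rule self_adjoint_eigenbasis)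
       (simp_all add: inner_eq_Re_cinner hermitian_cinner[OF assms])
  then obtain B where B: "finite B" "pairwise orthogonal B" "\<And>b. b \<in> B \<Longrightarrow> norm b = 1"
    "\<And>b. b \<in> B \<Longrightarrow> \<exists>\<mu>. A *v b = \<mu> *\<^sub>R b" "span B = UNIV"
    by blast
  then obtain \<mu> where \<mu>: "\<And>b. b \<in> B \<Longrightarrow> A *v b = \<mu> b *\<^sub>R b"
    by metis
  have expand: "(\<Sum>b\<in>B. Re (cinner b x) *\<^sub>R b) = x" for x
    using orthonormal_basis_expand[OF B(2,3) _ B(1), of x] B(5)
    by (simp add: inner_eq_Re_cinner[symmetric] inner_commute)
  have "(\<Sum>b\<in>B. cinner b x *s b) = 2 *\<^sub>R x" for x
  proof -
    \<comment> \<open>\<open>Re (cinner b (\<i> *s x))\<close> is minus the imaginary part of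
      \<open>cinner b x\<close>. The real parts thus expand \<open>x\<close>, and the imaginary
      parts expand \<open>\<i> *s x\<close>, which \<open>- \<i>\<close> turns into a second copy of
      \<open>x\<close>.\<close>
    have "cinner b x *s b = Re (cinner b x) *\<^sub>R b + (- \<i>) *s (Re (cinner b (\<i> *s x)) *\<^sub>R b)" for b
      by (simp add: vec_eq_iff cinner_scale_right scaleR_conv_of_real[where 'a = complex])
         (metis complex_eq distrib_right mult.assoc)
    then have "(\<Sum>b\<in>B. cinner b x *s b) = (\<Sum>b\<in>B. Re (cinner b x) *\<^sub>R b) +
        (\<Sum>b\<in>B. (- \<i>) *s (Re (cinner b (\<i> *s x)) *\<^sub>R b))"
      by (simp only: sum.distrib)
    also have "(\<Sum>b\<in>B. (- \<i>) *s (Re (cinner b (\<i> *s x)) *\<^sub>R b)) =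
        (- \<i>) *s (\<Sum>b\<in>B. Re (cinner b (\<i> *s x)) *\<^sub>R b)"
      by (simp only: vec.scale_sum_right)
    also have "\<dots> = x"
      unfolding expand by (simp add: vec_eq_iff)
    finally show ?thesis
      unfolding expand by (simp add: scaleR_2)
  qed
  then show ?thesis using that B(1,3) \<mu> by blast
qed

text \<open>The frame recovers twice every vector, so identities between matrices can be checked one
  eigenvector at a time.\<close>

lemma matrix_eq_on_frame:
  fixes A C :: "complex ^ 'n ^ 'n"
  assumes frame: "\<And>x. (\<Sum>b\<in>B. cinner b x *s b) = 2 *\<^sub>R x"
    and eq: "\<And>b. b \<in> B \<Longrightarrow> A *v b = C *v b"
  shows "A = C"
proof -
  have "A *v (\<Sum>b\<in>B. cinner b x *s b) = C *v (\<Sum>b\<in>B. cinner b x *s b)" for x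
    by (simp add: vec.linear_sum[OF matrix_vector_mul_linear_gen] vector_scalar_commute eq)
  then have "A *v x = C *v x" for x
    unfolding frame by (simp add: matrix_vector_mult_scaleR_right)
  then show ?thesis by (simp add: matrix_eq)
qed

text \<open>The condition under the definite description in \<open>inverse_sqrt\<close>, named to
  state existence and uniqueness.\<close>

definition is_inverse_sqrt :: "complex ^ 'n ^ 'n \<Rightarrow> complex ^ 'n ^ 'n \<Rightarrow> bool"
  where "is_inverse_sqrt M R \<longleftrightarrow> pos_semidef R \<and>
    (\<forall>v. (\<forall>u\<in>range ((*v) M). cinner u v = 0) \<longrightarrow> R *v v = 0) \<and>
    orth_projection_onto (R ** R ** M) (range ((*v) M))"

text \<open>Each projection fixes the range of the other, so \<open>P ** P' = P'\<close> and
  \<open>P' ** P = P\<close>; a Hermitian product of Hermitian matrices commutes.\<close>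

lemma orth_projection_unique:
  assumes "orth_projection_onto P S" "orth_projection_onto P' S"
  shows "P = P'"
proof -
  have absorb: "Q ** Q' = Q'" if "orth_projection_onto Q S" "orth_projection_onto Q' S"
    for Q Q' :: "complex ^ 'a ^ 'a"
  proof -
    have "Q *v (Q' *v v) = Q' *v v" for v
    proof -
      have "Q' *v v \<in> range ((*v) Q)"
        using that by (auto simp: orth_projection_onto_def)
      then obtain w where "Q' *v v = Q *v w" by blast
      then show ?thesis
        using that(1) by (simp add: orth_projection_onto_def matrix_vector_mul_assoc)
    qed
    then show ?thesis by (simp add: matrix_eq flip: matrix_vector_mul_assoc)
  qed
  have herm: "hermitian P" "hermitian P'"
    using assms by (simp_all add: orth_projection_onto_def)
  have "P' = P ** P'" using absorb[OF assms] by simp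
  also have "\<dots> = P' ** P"
    using hermitian_mult_imp_commute[OF herm] absorb[OF assms] herm by simp
  also have "\<dots> = P" using absorb[OF assms(2,1)] .
  finally show ?thesis by simp
qed

text \<open>With \<open>Q = R ** R ** M\<close>, the vector \<open>v - Q *v v\<close> is orthogonal
  to the image of \<open>M\<close>, where \<open>R\<close> vanishes. The second equation is the
  adjoint of the first.\<close>

lemma is_inverse_sqrt_absorb:
  assumes "is_inverse_sqrt M R"
  shows "R ** (R ** R ** M) = R" "(R ** R ** M) ** R = R"
proof -
  let ?Q = "R ** R ** M"
  have Q: "hermitian ?Q" "?Q ** ?Q = ?Q" "range ((*v) ?Q) = range ((*v) M)" and R: "hermitian R"
    using assms by (auto simp: is_inverse_sqrt_def orth_projection_onto_def pos_semidef_hermitian)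
  have "R *v (v - ?Q *v v) = 0" for v
  proof -
    have "cinner (?Q *v w) (v - ?Q *v v) = 0" for w
      using Q(2) by (simp add: hermitian_cinner[OF Q(1)] matrix_vector_mult_diff_distrib
          matrix_vector_mul_assoc) (simp add: cinner_def)
    then have "\<forall>u\<in>range ((*v) M). cinner u (v - ?Q *v v) = 0"
      unfolding Q(3)[symmetric] by blast
    then show ?thesis using assms by (simp add: is_inverse_sqrt_def)
  qed
  then show RQ: "R ** ?Q = R"
    by (simp add: matrix_eq matrix_vector_mult_diff_distrib matrix_vector_mul_assoc)
  then show "?Q ** R = R"
    using hermitian_mult_imp_commute[OF R Q(1)] R by simp
qed

text \<open>\<open>R\<close> and \<open>S\<close> yield the same projection. Absorbing it on the
  right of \<open>R ** R\<close> and on the left of \<open>S ** S\<close> shows that the squares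
  agree, and square roots are unique.\<close>

lemma is_inverse_sqrt_unique:
  assumes M: "hermitian M" and R: "is_inverse_sqrt M R" and S: "is_inverse_sqrt M S"
  shows "R = S"
proof -
  let ?Q = "R ** R ** M"
  have psd: "pos_semidef R" "pos_semidef S"
    using R S by (simp_all add: is_inverse_sqrt_def)
  have eq: "S ** S ** M = ?Q"
    using R S orth_projection_unique by (auto simp: is_inverse_sqrt_def)
  have "hermitian (S ** S)"
    using psd by (intro hermitian_commuting_mult) (simp_all add: pos_semidef_hermitian)
  moreover have "hermitian (S ** S ** M)"
    using S by (simp add: is_inverse_sqrt_def orth_projection_onto_def)
  \<comment> \<open>With \<open>M\<close> on the left, \<open>R ** R\<close> in front of this
    product forms the projection again.\<close>
  ultimately have "S ** S ** M = M ** (S ** S)"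
    using hermitian_mult_imp_commute M by blast
  then have Q: "?Q = M ** (S ** S)" using eq by simp
  have "R ** R = R ** (R ** ?Q)"
    by (simp only: is_inverse_sqrt_absorb(1)[OF R])
  also have "\<dots> = (R ** R ** M) ** S ** S"
    by (subst Q) (simp add: matrix_mul_assoc)
  also have "\<dots> = S ** S"
    using is_inverse_sqrt_absorb(2)[OF S] unfolding eq by simp
  finally show ?thesis using pos_semidef_sqrt_unique psd by blast
qed

text \<open>\<open>R\<close> is built by taking inverse square roots of the eigenvalues. A matrix
  \<open>T\<close> commuting with \<open>M\<close> preserves its eigenspaces, on each of which
  \<open>R\<close> is a scalar.\<close>

lemma is_inverse_sqrt_exists:
  fixes M :: "complex ^ 'n ^ 'n"
  assumes "pos_semidef M"
  obtains R where "is_inverse_sqrt M R" "\<And>T. T ** M = M ** T \<Longrightarrow> T ** R = R ** T"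
proof -
  note herm = pos_semidef_hermitian[OF assms]
  obtain B :: "(complex ^ 'n) set" and \<mu> where B: "finite B" "\<And>b. b \<in> B \<Longrightarrow> norm b = 1"
    and eig: "\<And>b. b \<in> B \<Longrightarrow> M *v b = \<mu> b *\<^sub>R b"
    and frame: "\<And>x. (\<Sum>b\<in>B. cinner b x *s b) = 2 *\<^sub>R x"
    using hermitian_eigenframe[OF herm] by blast
  have nonneg: "0 \<le> \<mu> b" if "b \<in> B" for b
    using pos_semidef_cinner[OF assms, of b] B(2)[OF that]
    by (simp add: eig[OF that] cinner_scaleR_right inner_eq_Re_cinner[symmetric] dot_square_norm)
  \<comment> \<open>Division by zero gives the value 0 on the kernel of \<open>M\<close>.\<close>
  define R where "R = (\<Sum>b\<in>B. (1 / (2 * sqrt (\<mu> b))) *\<^sub>R ket_bra b b)"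
  have R_apply: "R *v x = (\<Sum>b\<in>B. (1 / (2 * sqrt (\<mu> b))) *\<^sub>R (cinner b x *s b))" for x
    by (simp add: R_def matrix_vector_mult_sum_left scaleR_matrix_vector_mult ket_bra_mult)
  \<comment> \<open>Frame vectors with an eigenvalue other than \<open>l\<close> are orthogonal to
    \<open>w\<close>. Arbitrary eigenvectors are covered because \<open>T *v b\<close> need not
    belong to the frame.\<close>
  have R_eig: "R *v w = (1 / sqrt l) *\<^sub>R w" if "M *v w = l *\<^sub>R w" for w l
  proof -
    have "(1 / (2 * sqrt (\<mu> b))) *\<^sub>R (cinner b w *s b) = (1 / (2 * sqrt l)) *\<^sub>R (cinner b w *s b)"
      if "b \<in> B" for b
    proof (cases "cinner b w = 0")
      case False
      have "\<mu> b * cinner b w = l * cinner b w"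
        using hermitian_cinner[OF herm, of b w] \<open>M *v w = l *\<^sub>R w\<close>
        by (simp add: eig[OF that] cinner_scaleR_left cinner_scaleR_right)
      then have "\<mu> b = l" using False by simp
      then show ?thesis by simp
    qed simp
    then have "R *v w = (\<Sum>b\<in>B. (1 / (2 * sqrt l)) *\<^sub>R (cinner b w *s b))"
      unfolding R_apply by (intro sum.cong refl) blast
    also have "\<dots> = (1 / (2 * sqrt l)) *\<^sub>R (2 *\<^sub>R w)"
      by (simp only: frame scaleR_sum_right[symmetric])
    finally show ?thesis by simp
  qed
  have R_psd: "pos_semidef R"
    unfolding R_def using nonneg
    by (intro pos_semidef_sum pos_semidef_scaleR pos_semidef_ket_bra) simp
  have commute: "T ** R = R ** T" if T: "T ** M = M ** T" for T
  proof (rule matrix_eq_on_frame[OF frame])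
    fix b assume b: "b \<in> B"
    have "M *v (T *v b) = T *v (M *v b)"
      by (simp add: matrix_vector_mul_assoc T)
    then have "M *v (T *v b) = \<mu> b *\<^sub>R (T *v b)"
      by (simp add: eig[OF b] matrix_vector_mult_scaleR_right)
    from R_eig[OF this] R_eig[OF eig[OF b]] show "T ** R *v b = R ** T *v b"
      by (simp add: matrix_vector_mult_scaleR_right flip: matrix_vector_mul_assoc)
  qed
  define Q where "Q = R ** R ** M"
  have RM: "M ** R = R ** M" by (rule commute) simp
  then have "Q = R ** M ** R"
    unfolding Q_def by (metis matrix_mul_assoc)
  then have Q_herm: "hermitian Q"
    using hermitian_sandwich herm R_psd pos_semidef_hermitian by blast
  have Q_eig: "Q *v b = (if \<mu> b = 0 then 0 else b)" if "b \<in> B" for b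
    using nonneg[OF that] R_eig[OF eig[OF that]]
    by (simp add: Q_def eig[OF that] matrix_vector_mult_scaleR_right flip: matrix_vector_mul_assoc)
  have "Q ** Q = Q"
    by (rule matrix_eq_on_frame[OF frame]) (simp add: Q_eig flip: matrix_vector_mul_assoc)
  moreover have QM: "Q ** M = M"
    by (rule matrix_eq_on_frame[OF frame])
       (simp add: Q_eig eig matrix_vector_mult_scaleR_right flip: matrix_vector_mul_assoc)
  \<comment> \<open>This gives the inclusion of the range of \<open>Q\<close> in that of
    \<open>M\<close>; \<open>QM\<close> gives the converse.\<close>
  moreover have "Q = M ** (R ** R)"
    unfolding Q_def using RM by (metis matrix_mul_assoc)
  then have "range ((*v) Q) = range ((*v) M)"
    using QM by (auto simp: image_iff) (metis matrix_vector_mul_assoc)+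
  moreover have "R *v v = 0" if "\<forall>u\<in>range ((*v) M). cinner u v = 0" for v
  proof -
    \<comment> \<open>\<open>\<mu> b *\<^sub>R b\<close> lies in the image of \<open>M\<close>. So
      either \<open>cinner b v = 0\<close>, or \<open>\<mu> b = 0\<close> and the coefficient in
      \<open>R\<close> is 0.\<close>
    have "\<mu> b * cinner b v = 0" if "b \<in> B" for b
      using \<open>\<forall>u\<in>_. _\<close> eig[OF that] by (metis cinner_scaleR_left rangeI)
    then have "(1 / (2 * sqrt (\<mu> b))) *\<^sub>R (cinner b v *s b) = 0" if "b \<in> B" for b
      using that by fastforce
    then show ?thesis unfolding R_apply by (rule sum.neutral[OF ballI])
  qed
  ultimately have "is_inverse_sqrt M R"
    using R_psd Q_herm by (simp add: is_inverse_sqrt_def orth_projection_onto_def Q_def)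
  then show ?thesis using commute that by blast
qed

lemma inverse_sqrt_eqI:
  assumes "hermitian M" "is_inverse_sqrt M R"
  shows "inverse_sqrt M = R"
  unfolding inverse_sqrt_def is_inverse_sqrt_def[symmetric]
  using assms is_inverse_sqrt_unique by (intro the_equality) blast+

lemma is_inverse_sqrt_inverse_sqrt: "pos_semidef M \<Longrightarrow> is_inverse_sqrt M (inverse_sqrt M)"
  by (metis inverse_sqrt_eqI is_inverse_sqrt_exists pos_semidef_hermitian)

lemma inverse_sqrt_commute:
  "pos_semidef M \<Longrightarrow> T ** M = M ** T \<Longrightarrow> T ** inverse_sqrt M = inverse_sqrt M ** T"
  by (metis inverse_sqrt_eqI is_inverse_sqrt_exists pos_semidef_hermitian)

subsection \<open>Optimality for commuting multiples of projections\<close>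

lemma scaleR_matrix_mult_left: "(r *\<^sub>R A) ** B = r *\<^sub>R ((A :: complex ^ 'n ^ 'm) ** B)"
  and scaleR_matrix_mult_right: "A ** (r *\<^sub>R B) = r *\<^sub>R ((A :: complex ^ 'n ^ 'm) ** B)"
  by (simp_all add: vec_eq_iff matrix_matrix_mult_def scaleR_sum_right)

lemma matrix_mult_sum_left: "(\<Sum>i\<in>I. A i) ** B = (\<Sum>i\<in>I. (A i :: complex ^ 'n ^ 'm) ** B)"
  by (simp add: matrix_eq matrix_vector_mult_sum_left flip: matrix_vector_mul_assoc)

lemma matrix_mult_sum_right: "B ** (\<Sum>i\<in>I. A i) = (\<Sum>i\<in>I. (B :: complex ^ 'n ^ 'm) ** A i)"
  by (induction I rule: infinite_finite_induct) (simp_all add: matrix_add_ldistrib matrix_mult_zero_right)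

lemma trace_sum: "trace (\<Sum>i\<in>I. A i) = (\<Sum>i\<in>I. trace (A i :: complex ^ 'n ^ 'n))"
  by (induction I rule: infinite_finite_induct) (simp_all add: trace_add, simp_all add: trace_def)

lemma trace_scaleR: "trace (r *\<^sub>R A) = r * trace (A :: complex ^ 'n ^ 'n)"
  by (simp add: trace_def scaleR_conv_of_real[where 'a = complex] sum_distrib_left)

text \<open>By idempotence and cyclicity this is the trace of the positive semidefinite
  \<open>X ** F ** X\<close>.\<close>

lemma trace_mult_projection_nonneg:
  assumes "pos_semidef F" "hermitian X" "X ** X = X"
  shows "0 \<le> Re (trace (F ** X))"
proof -
  have "trace (F ** X) = trace (X ** F ** X)"
    by (metis assms(3) matrix_mul_assoc trace_mul_sym)
  then show ?thesis
    using pos_semidef_trace_nonneg[OF pos_semidef_sandwich] assms by metis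
qed

lemma orth_projection_onto_range_mult:
  assumes "orth_projection_onto Q (range ((*v) M))"
  shows "Q ** M = M"
proof -
  have "Q *v (M *v v) = M *v v" for v
  proof -
    have "M *v v \<in> range ((*v) Q)"
      using assms by (simp add: orth_projection_onto_def)
    then obtain w where "M *v v = Q *v w" by blast
    then show ?thesis
      using assms by (simp add: orth_projection_onto_def matrix_vector_mul_assoc)
  qed
  then show ?thesis by (simp add: matrix_eq flip: matrix_vector_mul_assoc)
qed

text \<open>This isolates what the coset densities have to supply: uniform probabilities, a common
  scale \<open>a\<close> for the projections, and commutation with the average.\<close>

lemma pretty_good_measurement_optimal:
  fixes \<rho> :: "'i \<Rightarrow> complex ^ 'n ^ 'n" and q a :: real
  defines "p \<equiv> \<lambda>_. q"
  assumes I: "finite I" and q: "q > 0" and a: "a > 0"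
    and psd: "\<And>i. i \<in> I \<Longrightarrow> pos_semidef (\<rho> i)"
    and idem: "\<And>i. i \<in> I \<Longrightarrow> \<rho> i ** \<rho> i = a *\<^sub>R \<rho> i"
    and commute: "\<And>i. i \<in> I \<Longrightarrow> \<rho> i ** average_state I p \<rho> = average_state I p \<rho> ** \<rho> i"
  shows "measurement_on I (pretty_good_measurement I p \<rho>)" (is ?meas)
    and "measurement_on I F \<Longrightarrow>
      success_probability I p \<rho> F \<le> success_probability I p \<rho> (pretty_good_measurement I p \<rho>)"
proof -
  define M where "M = average_state I p \<rho>"
  define R where "R = inverse_sqrt M"
  define Q where "Q = R ** R ** M"
  have M_eq: "M = (\<Sum>i\<in>I. q *\<^sub>R \<rho> i)"
    by (simp add: M_def average_state_def p_def)
  have E_eq: "pretty_good_measurement I p \<rho> i = q *\<^sub>R (R ** \<rho> i ** R)" for i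
    by (simp add: pretty_good_measurement_def p_def R_def M_def)
  have M: "pos_semidef M"
    unfolding M_eq using q psd by (intro pos_semidef_sum pos_semidef_scaleR) auto
  have is_R: "is_inverse_sqrt M R"
    unfolding R_def using M by (rule is_inverse_sqrt_inverse_sqrt)
  have R_psd: "pos_semidef R" and orth: "orth_projection_onto Q (range ((*v) M))"
    using is_R by (simp_all add: is_inverse_sqrt_def Q_def)
  have Q: "hermitian Q" "Q ** Q = Q"
    using orth by (simp_all add: orth_projection_onto_def)
  have MR: "M ** R = R ** M"
    unfolding R_def using M by (rule inverse_sqrt_commute) simp
  have \<rho>R: "\<rho> i ** R = R ** \<rho> i" if "i \<in> I" for i
    unfolding R_def using M commute[OF that] by (intro inverse_sqrt_commute) (simp_all add: M_def)
  have QM: "Q ** M = M"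
    using orth by (rule orth_projection_onto_range_mult)
  then have MQ: "M ** Q = M"
    using hermitian_mult_imp_commute[OF Q(1) pos_semidef_hermitian[OF M]] pos_semidef_hermitian[OF M]
    by simp
  \<comment> \<open>The kernel of \<open>M\<close> lies in that of every \<open>\<rho> i\<close>:
    where the form of \<open>M\<close> vanishes, so does each of its nonnegative summands. The
    vector \<open>v - Q *v v\<close> is in that kernel by \<open>MQ\<close>.\<close>
  have \<rho>Q: "\<rho> i ** Q = \<rho> i" if i: "i \<in> I" for i
  proof -
    have "\<rho> i *v (v - Q *v v) = 0" for v
    proof -
      let ?w = "v - Q *v v"
      have "M *v ?w = 0"
        by (simp add: matrix_vector_mult_diff_distrib matrix_vector_mul_assoc MQ)
      then have "Re (cinner ?w (M *v ?w)) = 0"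
        by (simp add: cinner_def)
      then have "(\<Sum>i\<in>I. q * Re (cinner ?w (\<rho> i *v ?w))) = 0"
        by (simp add: M_eq matrix_vector_mult_sum_left scaleR_matrix_vector_mult cinner_sum_right
            cinner_scaleR_right)
      then have "q * Re (cinner ?w (\<rho> i *v ?w)) = 0"
        using I i q psd by (subst (asm) sum_nonneg_eq_0_iff) (simp_all add: pos_semidef_cinner)
      then show ?thesis
        using pos_semidef_cinner_eq_0[OF psd[OF i]] q by simp
    qed
    then show ?thesis
      by (simp add: matrix_eq matrix_vector_mult_diff_distrib matrix_vector_mul_assoc)
  qed
  have Q\<rho>: "Q ** \<rho> i = \<rho> i" if "i \<in> I" for i
    using hermitian_mult_imp_commute[OF pos_semidef_hermitian[OF psd[OF that]] Q(1)]
      \<rho>Q[OF that] pos_semidef_hermitian[OF psd[OF that]] by simp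

  show ?meas
  proof -
    have "pos_semidef (pretty_good_measurement I p \<rho> i)" if "i \<in> I" for i
      unfolding E_eq using psd[OF that] q R_psd
      by (intro pos_semidef_scaleR pos_semidef_sandwich pos_semidef_hermitian) auto
    moreover have "(\<Sum>i\<in>I. pretty_good_measurement I p \<rho> i) = R ** M ** R"
      by (simp add: E_eq M_eq matrix_mult_sum_left matrix_mult_sum_right
          scaleR_matrix_mult_left scaleR_matrix_mult_right)
    then have "(\<Sum>i\<in>I. pretty_good_measurement I p \<rho> i) = Q"
      unfolding Q_def using MR by (metis matrix_mul_assoc)
    \<comment> \<open>The extra outcome is the projection onto the orthogonal complement of the
      image of \<open>M\<close>.\<close>
    moreover have "(mat 1 - Q) ** (mat 1 - Q) = mat 1 - Q"
      by (simp add: matrix_diff_ldistrib matrix_diff_rdistrib Q(2))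
    then have "pos_semidef (mat 1 - Q)"
      using Q(1) by (intro pos_semidef_projection hermitian_diff hermitian_mat_1)
    ultimately show ?thesis
      unfolding measurement_on_def by (intro conjI ballI exI[of _ "mat 1 - Q"]) simp_all
  qed

  show "success_probability I p \<rho> F \<le> success_probability I p \<rho> (pretty_good_measurement I p \<rho>)"
    if F: "measurement_on I F"
  proof -
    obtain F\<^sub>0 where F0: "pos_semidef F\<^sub>0" "(\<Sum>i\<in>I. F i) + F\<^sub>0 = mat 1"
      and F_psd: "\<And>i. i \<in> I \<Longrightarrow> pos_semidef (F i)"
      using F by (auto simp: measurement_on_def)
    have bound: "Re (trace (F i ** \<rho> i)) \<le> a * Re (trace (F i ** Q))" if i: "i \<in> I" for i
    proof -
      \<comment> \<open>A difference of two projections, the smaller absorbed by \<open>Q\<close> on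
        both sides, hence itself a projection.\<close>
      define X where "X = Q - (1 / a) *\<^sub>R \<rho> i"
      have "hermitian X"
        unfolding X_def
        by (intro hermitian_diff hermitian_scaleR Q(1) pos_semidef_hermitian[OF psd[OF i]])
      moreover have "X ** X = X"
        using a by (simp add: X_def matrix_diff_ldistrib matrix_diff_rdistrib Q \<rho>Q[OF i] Q\<rho>[OF i]
            scaleR_matrix_mult_left scaleR_matrix_mult_right idem[OF i])
      ultimately have "0 \<le> Re (trace (F i ** X))"
        using F_psd[OF i] by (intro trace_mult_projection_nonneg)
      also have "trace (F i ** X) = trace (F i ** Q) - (1 / a) * trace (F i ** \<rho> i)"
        by (simp add: X_def matrix_diff_ldistrib trace_sub trace_scaleR scaleR_matrix_mult_right)
      finally show ?thesis using a by (simp add: field_simps)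
    qed
    have "success_probability I p \<rho> F \<le> (\<Sum>i\<in>I. q * (a * Re (trace (F i ** Q))))"
      unfolding success_probability_def p_def using q bound by (intro sum_mono mult_left_mono) auto
    also have "\<dots> = q * a * Re (trace ((\<Sum>i\<in>I. F i) ** Q))"
      by (simp add: matrix_mult_sum_left trace_sum sum_distrib_left mult_ac)
    also have "(\<Sum>i\<in>I. F i) = mat 1 - F\<^sub>0"
      using F0(2) by (simp add: eq_diff_eq)
    also have "Re (trace ((mat 1 - F\<^sub>0) ** Q)) = Re (trace Q) - Re (trace (F\<^sub>0 ** Q))"
      by (simp add: matrix_diff_rdistrib trace_sub)
    \<comment> \<open>The extra outcome can only lower the bound.\<close>
    also have "q * a * \<dots> \<le> q * a * Re (trace Q)"
      using q a trace_mult_projection_nonneg[OF F0(1) Q] by (intro mult_left_mono) auto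
    also have "\<dots> = (\<Sum>i\<in>I. q * (q * (a * Re (trace (R ** R ** \<rho> i)))))"
      by (simp add: Q_def M_eq matrix_mult_sum_right scaleR_matrix_mult_right trace_sum trace_scaleR
          sum_distrib_left mult_ac)
    also have "\<dots> = success_probability I p \<rho> (pretty_good_measurement I p \<rho>)"
    proof -
      have "q * (q * (a * Re (trace (R ** R ** \<rho> i)))) =
          p i * Re (trace (pretty_good_measurement I p \<rho> i ** \<rho> i))" if i: "i \<in> I" for i
      proof -
        \<comment> \<open>After commuting \<open>R\<close> past \<open>\<rho> i\<close>, idempotence
          up to scale supplies the same factor \<open>a\<close> as in the upper bound.\<close>
        have "R ** \<rho> i ** R ** \<rho> i = R ** R ** (\<rho> i ** \<rho> i)"
          using \<rho>R[OF i] by (metis matrix_mul_assoc)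
        then show ?thesis
          unfolding E_eq
          by (simp add: p_def scaleR_matrix_mult_left idem[OF i] scaleR_matrix_mult_right trace_scaleR)
      qed
      then show ?thesis
        unfolding success_probability_def by (intro sum.cong refl)
    qed
    finally show ?thesis .
  qed
qed

subsection \<open>Coset states\<close>

context group
begin

text \<open>Membership becomes a condition on \<open>H\<close> alone, which suits both the subgroup
  axioms and reindexing over conjugators.\<close>

lemma mem_conj_subgroup_iff:
  assumes "subgroup H G" "g \<in> carrier G" "x \<in> carrier G"
  shows "x \<in> conj_subgroup G H g \<longleftrightarrow> g \<otimes> x \<otimes> inv g \<in> H"
proof
  assume "x \<in> conj_subgroup G H g"
  then obtain h where h: "h \<in> H" "x = inv g \<otimes> h \<otimes> g" by (auto simp: conj_subgroup_def)
  then have "g \<otimes> x \<otimes> inv g = h"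
    using assms subgroup.mem_carrier[OF assms(1)] by (simp add: m_assoc) (simp flip: m_assoc)
  then show "g \<otimes> x \<otimes> inv g \<in> H" using h by simp
next
  assume "g \<otimes> x \<otimes> inv g \<in> H"
  moreover have "x = inv g \<otimes> (g \<otimes> x \<otimes> inv g) \<otimes> g"
    using assms by (simp add: m_assoc) (simp flip: m_assoc)
  ultimately show "x \<in> conj_subgroup G H g" unfolding conj_subgroup_def by blast
qed

lemma subgroup_conj_subgroup:
  assumes H: "subgroup H G" and g: "g \<in> carrier G"
  shows "subgroup (conj_subgroup G H g) G"
proof (rule subgroupI)
  interpret H: subgroup H G by fact
  show sub: "conj_subgroup G H g \<subseteq> carrier G"
    using g by (auto simp: conj_subgroup_def)
  show "conj_subgroup G H g \<noteq> {}"
    unfolding conj_subgroup_def using H.one_closed by blast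
  show "inv a \<in> conj_subgroup G H g" if "a \<in> conj_subgroup G H g" for a
  proof -
    have a: "a \<in> carrier G" "g \<otimes> a \<otimes> inv g \<in> H"
      using that sub mem_conj_subgroup_iff[OF H g] by auto
    from H.m_inv_closed[OF a(2)] show ?thesis
      using a g mem_conj_subgroup_iff[OF H g] by (simp add: inv_mult_group m_assoc)
  qed
  show "a \<otimes> b \<in> conj_subgroup G H g"
    if "a \<in> conj_subgroup G H g" "b \<in> conj_subgroup G H g" for a b
  proof -
    have ab: "a \<in> carrier G" "b \<in> carrier G" "g \<otimes> a \<otimes> inv g \<in> H" "g \<otimes> b \<otimes> inv g \<in> H"
      using that sub mem_conj_subgroup_iff[OF H g] by auto
    have "g \<otimes> a \<otimes> inv g \<otimes> (g \<otimes> b \<otimes> inv g) = g \<otimes> (a \<otimes> b) \<otimes> inv g"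
      using ab(1,2) g by (simp add: m_assoc) (simp flip: m_assoc)
    then show ?thesis
      using H.m_closed[OF ab(3,4)] ab(1,2) g mem_conj_subgroup_iff[OF H g] by simp
  qed
qed

lemma card_conj_subgroup:
  assumes "subgroup H G" "g \<in> carrier G"
  shows "card (conj_subgroup G H g) = card H"
proof -
  have "inj_on (\<lambda>h. inv g \<otimes> h \<otimes> g) H"
    using assms(2) subgroup.mem_carrier[OF assms(1)] by (intro inj_onI) simp
  then show ?thesis by (simp add: conj_subgroup_def card_image)
qed

end

text \<open>The group fills its type, so matrix indices are exactly group elements and sums over
  \<open>UNIV\<close> run over the group.\<close>

locale full_finite_group = group G for G :: "('a::finite, 'b) monoid_scheme" (structure) +
  assumes carrier_UNIV: "carrier G = UNIV"
begin

lemma in_carrier [simp]: "x \<in> carrier G"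
  by (simp add: carrier_UNIV)

lemma inv_mult_cancel [simp]: "inv x \<otimes> (x \<otimes> y) = y" "x \<otimes> (inv x \<otimes> y) = y"
  by (simp_all flip: m_assoc)

text \<open>The sum counts the \<open>c\<close> whose coset \<open>cK\<close> contains both
  \<open>x\<close> and \<open>y\<close>. There are none unless \<open>xK = yK\<close>; then they are
  the elements of \<open>xK\<close>. Both the entries of a coset density and those of its square are
  such sums.\<close>

lemma sum_coset_indicators:
  assumes "subgroup K G"
  shows "(\<Sum>c\<in>UNIV. of_bool (inv c \<otimes> x \<in> K) * of_bool (inv c \<otimes> y \<in> K)) =
    (of_nat (card K) * of_bool (inv x \<otimes> y \<in> K) :: complex)"
proof -
  interpret K: subgroup K G by fact
  have *: "inv c \<otimes> y \<in> K \<longleftrightarrow> inv x \<otimes> y \<in> K" if "inv c \<otimes> x \<in> K" for c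
  proof
    assume "inv c \<otimes> y \<in> K"
    from K.m_closed[OF K.m_inv_closed[OF that] this] show "inv x \<otimes> y \<in> K"
      by (simp add: inv_mult_group m_assoc)
  next
    assume "inv x \<otimes> y \<in> K"
    from K.m_closed[OF that this] show "inv c \<otimes> y \<in> K"
      by (simp add: m_assoc)
  qed
  have "(\<Sum>c\<in>UNIV. of_bool (inv c \<otimes> x \<in> K) * of_bool (inv c \<otimes> y \<in> K)) =
      (\<Sum>c\<in>UNIV. of_bool (inv c \<otimes> x \<in> K) * (of_bool (inv x \<otimes> y \<in> K) :: complex))"
  proof (intro sum.cong refl)
    fix c
    show "of_bool (inv c \<otimes> x \<in> K) * of_bool (inv c \<otimes> y \<in> K) =
        of_bool (inv c \<otimes> x \<in> K) * (of_bool (inv x \<otimes> y \<in> K) :: complex)"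
      by (cases "inv c \<otimes> x \<in> K") (simp_all only: * of_bool_eq mult_zero_left)
  qed
  also have "\<dots> = (\<Sum>k\<in>UNIV. of_bool (k \<in> K) * of_bool (inv x \<otimes> y \<in> K))"
    by (rule sum.reindex_bij_witness[of _ "\<lambda>k. x \<otimes> inv k" "\<lambda>c. inv c \<otimes> x"])
       (simp_all add: inv_mult_group m_assoc)
  also have "\<dots> = of_nat (card K) * of_bool (inv x \<otimes> y \<in> K)"
    by (simp add: sum_of_bool_eq flip: sum_distrib_right)
  finally show ?thesis .
qed

lemma coset_state_nth:
  assumes "subgroup H G"
  shows "coset_state G H g c $ x =
    of_real (1 / sqrt (real (card H))) * of_bool (inv c \<otimes> x \<in> conj_subgroup G H g)"
proof -
  have "axis (c \<otimes> h) 1 $ x = (if h = inv c \<otimes> x then 1 else 0 :: complex)" for h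
    by (auto simp: axis_def m_assoc)
  then show ?thesis
    by (simp add: coset_state_def scaleR_conv_of_real[where 'a = complex])
qed

lemma cnj_of_bool: "cnj (of_bool P) = of_bool P"
  by (cases P) simp_all

lemma coset_density_nth:
  assumes "subgroup H G"
  shows "coset_density G H g $ x $ y =
    of_real (1 / card (carrier G)) * of_bool (inv x \<otimes> y \<in> conj_subgroup G H g)"
proof -
  let ?K = "conj_subgroup G H g"
  have H: "card H \<noteq> 0"
    using subgroup.one_closed[OF assms] by auto
  have "coset_density G H g $ x $ y = of_real (1 / card (carrier G)) *
      (\<Sum>c\<in>UNIV. (of_real (1 / sqrt (real (card H))))\<^sup>2 *
        (of_bool (inv c \<otimes> x \<in> ?K) * of_bool (inv c \<otimes> y \<in> ?K)))"
    by (simp add: coset_density_def ket_bra_def coset_state_nth[OF assms] carrier_UNIV cnj_of_bool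
        scaleR_conv_of_real[where 'a = complex] power2_eq_square mult_ac)
  \<comment> \<open>The squared normalisation cancels the number of representatives of each
    coset.\<close>
  also have "(of_real (1 / sqrt (real (card H))))\<^sup>2 = (1 / of_nat (card H) :: complex)"
    by (simp add: power_divide flip: of_real_power)
  finally show ?thesis
    unfolding sum_distrib_left[symmetric] sum_coset_indicators[OF subgroup_conj_subgroup[OF assms in_carrier]]
    using H by (simp add: card_conj_subgroup[OF assms])
qed

section \<open>Positivity, idempotence up to scale and commutation for coset densities\<close>

lemma pos_semidef_coset_density: "pos_semidef (coset_density G H g)"
  unfolding coset_density_def
  by (intro pos_semidef_scaleR pos_semidef_sum pos_semidef_ket_bra) simp

lemma coset_density_idem:
  assumes "subgroup H G"
  shows "coset_density G H g ** coset_density G H g =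
    (card H / card (carrier G)) *\<^sub>R coset_density G H g"
proof -
  let ?K = "conj_subgroup G H g"
  have K: "subgroup ?K G" using assms by (simp add: subgroup_conj_subgroup)
  \<comment> \<open>Closure under inverses turns the first factor of the matrix product into the
    form required by \<open>sum_coset_indicators\<close>.\<close>
  have sym: "inv x \<otimes> z \<in> ?K \<longleftrightarrow> inv z \<otimes> x \<in> ?K" for x z
    using subgroup.m_inv_closed[OF K, of "inv x \<otimes> z"] subgroup.m_inv_closed[OF K, of "inv z \<otimes> x"]
    by (auto simp: inv_mult_group)
  have "(coset_density G H g ** coset_density G H g) $ x $ y =
      (of_real (1 / card (carrier G)))\<^sup>2 *
      (\<Sum>z\<in>UNIV. of_bool (inv z \<otimes> x \<in> ?K) * of_bool (inv z \<otimes> y \<in> ?K))" for x y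
    unfolding matrix_matrix_mult_def coset_density_nth[OF assms] sum_distrib_left
    by (simp add: sym[of x] power2_eq_square mult_ac)
  then show ?thesis
    by (simp add: vec_eq_iff sum_coset_indicators[OF K] coset_density_nth[OF assms]
        card_conj_subgroup[OF assms] scaleR_conv_of_real[where 'a = complex] power2_eq_square)
qed

text \<open>Such matrices multiply by convolution, and the hypothesis makes \<open>m\<close> a class
  function, hence central in the group algebra.\<close>

lemma convolution_matrix_commute:
  fixes r m :: "'a \<Rightarrow> complex"
  assumes "\<And>u w. m (u \<otimes> w) = m (w \<otimes> u)"
  shows "(\<chi> x y. r (inv x \<otimes> y)) ** (\<chi> x y. m (inv x \<otimes> y)) =
    (\<chi> x y. m (inv x \<otimes> y)) ** (\<chi> x y. r (inv x \<otimes> y))"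
proof -
  have "(\<Sum>z\<in>UNIV. r (inv x \<otimes> z) * m (inv z \<otimes> y)) =
      (\<Sum>z\<in>UNIV. m (inv x \<otimes> z) * r (inv z \<otimes> y))" for x y
  \<comment> \<open>The substitution \<open>y \<otimes> inv z \<otimes> x\<close> keeps the argument
    of \<open>r\<close> and sends that of \<open>m\<close> to a conjugate of
    \<open>inv z \<otimes> y\<close>.\<close>
  proof (rule sum.reindex_bij_witness[of _ "\<lambda>z. x \<otimes> inv z \<otimes> y" "\<lambda>z. y \<otimes> inv z \<otimes> x"])
    fix z
    show "m (inv x \<otimes> (y \<otimes> inv z \<otimes> x)) * r (inv (y \<otimes> inv z \<otimes> x) \<otimes> y) = r (inv x \<otimes> z) * m (inv z \<otimes> y)"
      using assms[of "inv x" "y \<otimes> inv z \<otimes> x"] assms[of "inv z" y]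
      by (simp add: inv_mult_group m_assoc)
  qed (simp_all add: inv_mult_group m_assoc)
  then show ?thesis by (simp add: vec_eq_iff matrix_matrix_mult_def)
qed

lemma coset_density_commute_average:
  assumes "subgroup H G"
  shows "coset_density G H g ** average_state (carrier G) (\<lambda>_. q) (coset_density G H) =
    average_state (carrier G) (\<lambda>_. q) (coset_density G H) ** coset_density G H g"
proof -
  define m :: "'a \<Rightarrow> complex" where
    "m w = (\<Sum>k\<in>UNIV. of_real q * (of_real (1 / card (carrier G)) * of_bool (w \<in> conj_subgroup G H k)))" for w
  \<comment> \<open>\<open>u \<otimes> w\<close> lies in the conjugate by \<open>k\<close> exactly
    when \<open>w \<otimes> u\<close> lies in the conjugate by \<open>k \<otimes> inv w\<close>, and
    the sum runs over all conjugators.\<close>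
  have "m (u \<otimes> w) = m (w \<otimes> u)" for u w
    unfolding m_def
    by (rule sum.reindex_bij_witness[of _ "\<lambda>k. k \<otimes> w" "\<lambda>k. k \<otimes> inv w"])
       (simp_all add: mem_conj_subgroup_iff[OF assms] inv_mult_group m_assoc)
  note commute = convolution_matrix_commute[of m, OF this]
  have density: "coset_density G H g = (\<chi> x y. (\<lambda>w. of_real (1 / card (carrier G)) *
      of_bool (w \<in> conj_subgroup G H g)) (inv x \<otimes> y))"
    by (simp add: vec_eq_iff coset_density_nth[OF assms])
  have average: "average_state (carrier G) (\<lambda>_. q) (coset_density G H) = (\<chi> x y. m (inv x \<otimes> y))"
    by (simp add: vec_eq_iff average_state_def m_def carrier_UNIV coset_density_nth[OF assms]
        scaleR_conv_of_real[where 'a = complex])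
  show ?thesis unfolding average density by (rule commute)
qed

end

theorem theorem2:
  fixes G :: "('a::finite, 'b) monoid_scheme" and H :: "'a set"
    and p :: "'a \<Rightarrow> real" and \<rho> E :: "'a \<Rightarrow> complex ^ 'a ^ 'a"
  assumes "group G" and "carrier G = UNIV" and "subgroup H G"
    and "\<rho> = coset_density G H"
    and "p = (\<lambda>g. 1 / real (card (carrier G)))"
    and "E = pretty_good_measurement (carrier G) p \<rho>"
  shows "measurement_on (carrier G) E \<and>
    (\<forall>F. measurement_on (carrier G) F \<longrightarrow>
      success_probability (carrier G) p \<rho> F \<le> success_probability (carrier G) p \<rho> E)"
proof -
  interpret full_finite_group G
    using assms(1,2) by (simp add: full_finite_group_def full_finite_group_axioms_def)
  have n: "1 / real (card (carrier G)) > 0"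
    by (simp add: carrier_UNIV card_gt_0_iff)
  have "card H > 0"
    using subgroup.one_closed[OF assms(3)] by (auto simp: card_gt_0_iff)
  then have a: "card H / real (card (carrier G)) > 0"
    by (simp add: carrier_UNIV card_gt_0_iff)
  have fin: "finite (carrier G)" by simp
  \<comment> \<open>Here \<open>q\<close> is \<open>1 / |G|\<close> and the scale \<open>a\<close>
    is \<open>|H| / |G|\<close>.\<close>
  note optimal = pretty_good_measurement_optimal[OF fin n a pos_semidef_coset_density
      coset_density_idem[OF assms(3)] coset_density_commute_average[OF assms(3)]]
  show ?thesis unfolding assms(4-6) using optimal by blast
qed

end
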